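(* Let $n\ge 2$, let $\boldsymbol{z}=(z_1,\dots,z_n)\in\mathbb{C}^n$ and $\boldsymbol{w}=(w_1,\dots,w_n)\in \mathbb{C}^n$ satisfy $\pi_n(\boldsymbol{z}) = \boldsymbol{w}$ and $|w_j|< \binom{n}{j}$ for $j = 1, \ldots, n$. Assume also that for all $1\leq m_1< m_2\leq n$, writing $(w^{(2)}_{m_1},w^{(2)}_{m_2})=\pi_2(z_{m_1},z_{m_2})=(z_{m_1}+z_{m_2},\,z_{m_1}z_{m_2})$, one has $|w^{(2)}_{m_1}|<2$ and $|w^{(2)}_{m_2}|<1$. Then $\boldsymbol{w} \in \mathbb{G}_n$ if and only if \[ \prod_{j=1}^n(1-|z_j|^2)>0.\]
   Context: Let $\mathbb{D}=\{z\in\mathbb{C}:|z|<1\}$. For $n\ge 2$, the symmetrization map $\pi_n:\mathbb{C}^n\to\mathbb{C}^n$ is $\pi_n(z_1,\dots,z_n)=(e_1,\dots,e_n)$, where $e_k=\sum_{1\le i_1<\dots<i_k\le n} z_{i_1}\cdots z_{i_k}$ is the $k$-th elementary symmetric polynomial in $z_1,\dots,z_n$. Set $\mathbb{G}_n=\{\pi_n(\boldsymbol{z}):\boldsymbol{z}\in\mathbb{D}^n\}$. The notation $(w^{(2)}_{m_1},w^{(2)}_{m_2})$ depends on the pair $(m_1,m_2)$. *)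

theory Defs
  imports Complex_Main "HOL-Library.FuncSet"
begin

text \<open>Points of $A^n$ are extensional functions on \<open>{1..n}\<close> (value \<open>undefined\<close> outside), so that
  equality of points is equality of their \<open>n\<close> coordinates, indexed from 1.\<close>

definition tuples :: "nat \<Rightarrow> 'a set \<Rightarrow> (nat \<Rightarrow> 'a) set" where
  "tuples n A = {1..n} \<rightarrow>\<^sub>E A"

definition mk_pair :: "'a \<Rightarrow> 'a \<Rightarrow> nat \<Rightarrow> 'a" where
  "mk_pair a b = (\<lambda>i\<in>{1..2}. if i = 1 then a else b)"

definition unit_disc :: "complex set" where
  "unit_disc = {z. cmod z < 1}"

text \<open>An index tuple $1 \le i_1 < \dots < i_k \le n$ is encoded as the \<open>k\<close>-element set
  $\{i_1, \dots, i_k\}$.\<close>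

definition elem_sym :: "nat \<Rightarrow> nat \<Rightarrow> (nat \<Rightarrow> complex) \<Rightarrow> complex" where
  "elem_sym n k z = (\<Sum>I | I \<subseteq> {1..n} \<and> card I = k. \<Prod>i\<in>I. z i)"

definition symmetrization :: "nat \<Rightarrow> (nat \<Rightarrow> complex) \<Rightarrow> nat \<Rightarrow> complex" where
  "symmetrization n z = (\<lambda>k\<in>{1..n}. elem_sym n k z)"

definition symmetrized_polydisc :: "nat \<Rightarrow> (nat \<Rightarrow> complex) set" where
  "symmetrized_polydisc n = symmetrization n ` tuples n unit_disc"

lemma mk_pair_in_tuples: "mk_pair a b \<in> tuples 2 UNIV"
  by (auto simp: mk_pair_def tuples_def)

lemma symmetrization_2: "symmetrization 2 (mk_pair a b) = mk_pair (a + b) (a * b)"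
proof
  fix k :: nat
  have P: "Pow {1..2::nat} = {{}, {1}, {2}, {1, 2}}"
  proof -
    have "{1..2::nat} = insert 1 (insert 2 {})" by auto
    then show ?thesis by (simp add: Pow_insert insert_commute)
  qed
  have sub: "I \<subseteq> {1..2::nat} \<longleftrightarrow> I = {} \<or> I = {1} \<or> I = {2} \<or> I = {1, 2}" for I
    unfolding Pow_iff[symmetric] P by simp
  have 1: "{I. I \<subseteq> {1..2::nat} \<and> card I = 1} = {{1}, {2}}"
    unfolding sub by auto
  have 2: "{I. I \<subseteq> {1..2::nat} \<and> card I = 2} = {{1, 2}}"
    unfolding sub by auto
  have e1: "elem_sym 2 1 (mk_pair a b) = a + b"
    unfolding elem_sym_def 1 by (simp add: mk_pair_def)
  have e2: "elem_sym 2 2 (mk_pair a b) = a * b"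
    unfolding elem_sym_def 2 by (simp add: mk_pair_def)
  consider "k = 1" | "k = 2" | "k \<notin> {1..2}" by fastforce
  then show "symmetrization 2 (mk_pair a b) k = mk_pair (a + b) (a * b) k"
  proof cases
    case 1
    then show ?thesis using e1 by (simp add: symmetrization_def mk_pair_def)
  next
    case 2
    then show ?thesis using e2 by (simp add: symmetrization_def mk_pair_def)
  next
    case 3
    then show ?thesis by (simp only: symmetrization_def mk_pair_def restrict_apply if_False)
  qed
qed

end

theory Submission
  imports Defs
begin

text \<open>By Vieta, the nonzero coordinates of a point are determined up to order by its
  symmetrization, so a point lies over \<open>symmetrized_polydisc n\<close> only if all its coordinates lie in
  the disc. If \<open>\<bar>z\<^sub>j\<bar> \<ge> 1\<close> for some \<open>j\<close>, then the condition \<open>\<bar>z\<^sub>i z\<^sub>j\<bar> < 1\<close> on pairs puts all other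
  coordinates in the disc, so exactly one factor of the product is nonpositive.\<close>

lemma elem_sym_0: "elem_sym n 0 z = 1"
proof -
  have "{I. I \<subseteq> {1..n} \<and> card I = 0} = {{}}"
    by (auto dest: finite_subset)
  then show ?thesis
    by (simp add: elem_sym_def)
qed

text \<open>Generating function of the elementary symmetric polynomials: expand the product over
  subsets of the index set, then group the subsets by cardinality.\<close>

lemma prod_one_plus_scaled_eq_elem_sym:
  "(\<Prod>i=1..n. 1 + t * z i) = (\<Sum>k=0..n. t ^ k * elem_sym n k z)"
proof -
  have "(\<Prod>i=1..n. 1 + t * z i) = (\<Sum>I\<in>Pow {1..n}. \<Prod>i\<in>I. t * z i)"
    using prod_add[of "{1..n}" "\<lambda>i. t * z i" "\<lambda>_. 1"] by (simp add: add.commute)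
  also have "\<dots> = (\<Sum>I\<in>Pow {1..n}. t ^ card I * (\<Prod>i\<in>I. z i))"
    by (simp add: prod.distrib)
  also have "\<dots> = (\<Sum>k=0..n. \<Sum>I | I \<in> Pow {1..n} \<and> card I = k. t ^ card I * (\<Prod>i\<in>I. z i))"
    by (rule sum.group[symmetric]) (auto dest: card_mono[rotated])
  also have "\<dots> = (\<Sum>k=0..n. t ^ k * elem_sym n k z)"
    unfolding elem_sym_def sum_distrib_left by (intro sum.cong) auto
  finally show ?thesis .
qed

text \<open>Both points give the same polynomial in \<open>t\<close>, whose roots are the
  \<open>- 1 / c\<close> for nonzero coordinates \<open>c\<close>. A zero coordinate contributes no
  root, hence the \<open>insert 0\<close>.\<close>

lemma symmetrization_eq_imp_image_subset:
  assumes "symmetrization n x = symmetrization n y"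
  shows "x ` {1..n} \<subseteq> insert 0 (y ` {1..n})"
proof
  \<comment> \<open>The constant coefficient \<open>k = 0\<close> is not recorded by
    \<open>symmetrization\<close>, but it is always 1.\<close>
  have e: "elem_sym n k x = elem_sym n k y" if "k \<in> {0..n}" for k
    using that fun_cong[OF assms, of k]
    by (cases "k = 0") (auto simp: elem_sym_0 symmetrization_def)
  fix c assume "c \<in> x ` {1..n}"
  then obtain j where j: "j \<in> {1..n}" "c = x j" by auto
  show "c \<in> insert 0 (y ` {1..n})"
  proof (cases "c = 0")
    case False
    have "(\<Prod>i=1..n. 1 + (- 1 / c) * y i) = (\<Prod>i=1..n. 1 + (- 1 / c) * x i)"
      unfolding prod_one_plus_scaled_eq_elem_sym using e by (intro sum.cong) auto
    also have "\<dots> = 0"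
      using j False by (intro prod_zero) (auto intro!: bexI[of _ j])
    finally obtain i where "i \<in> {1..n}" "1 + (- 1 / c) * y i = 0"
      by auto
    with False show ?thesis by (auto simp: field_simps)
  qed simp
qed

theorem theorem3p1:
  fixes n :: nat and z w :: "nat \<Rightarrow> complex"
  assumes "n \<ge> 2"
    and "z \<in> tuples n UNIV"
    and "w \<in> tuples n UNIV"
    and "symmetrization n z = w"
    and "\<forall>j\<in>{1..n}. cmod (w j) < real (n choose j)"
    and "\<forall>m1 m2. 1 \<le> m1 \<and> m1 < m2 \<and> m2 \<le> n \<longrightarrow>
           cmod (symmetrization 2 (mk_pair (z m1) (z m2)) 1) < 2 \<and>
           cmod (symmetrization 2 (mk_pair (z m1) (z m2)) 2) < 1"
  shows "w \<in> symmetrized_polydisc n \<longleftrightarrow> (\<Prod>j=1..n. 1 - (cmod (z j))\<^sup>2) > 0"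
proof -
  have sq_less_1_iff: "(cmod c)\<^sup>2 < 1 \<longleftrightarrow> cmod c < 1" for c
    using abs_square_less_1[of "cmod c"] by simp
  have pair: "cmod (z i) * cmod (z j) < 1" if "i \<in> {1..n}" "j \<in> {1..n}" "i < j" for i j
    using assms(6)[rule_format, of i j] that
    unfolding symmetrization_2 by (simp add: mk_pair_def norm_mult)
  show ?thesis
  proof
    assume "w \<in> symmetrized_polydisc n"
    then obtain y where y: "y \<in> tuples n unit_disc" "symmetrization n z = symmetrization n y"
      using assms(4) by (auto simp: symmetrized_polydisc_def)
    have "cmod (z j) < 1" if "j \<in> {1..n}" for j
    proof -
      have "z j \<in> insert 0 (y ` {1..n})"
        using symmetrization_eq_imp_image_subset[OF y(2)] that by blast
      \<comment> \<open>The extra value 0 is harmless, as it lies in the disc.\<close>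
      with y(1) show ?thesis
        by (auto simp: tuples_def unit_disc_def PiE_iff)
    qed
    then show "(\<Prod>j=1..n. 1 - (cmod (z j))\<^sup>2) > 0"
      by (intro prod_pos) (simp add: sq_less_1_iff)
  next
    assume pos: "(\<Prod>j=1..n. 1 - (cmod (z j))\<^sup>2) > 0"
    have "cmod (z j) < 1" if j: "j \<in> {1..n}" for j
    proof (rule ccontr)
      assume "\<not> cmod (z j) < 1"
      then have ge: "1 \<le> cmod (z j)" by simp
      have "cmod (z i) < 1" if i: "i \<in> {1..n} - {j}" for i
      proof (rule ccontr)
        assume "\<not> cmod (z i) < 1"
        then have "1 * 1 \<le> cmod (z i) * cmod (z j)"
          using ge by (intro mult_mono) auto
        \<comment> \<open>\<open>pair\<close> needs ordered indices, so both orders are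
          supplied.\<close>
        with pair[of i j] pair[of j i] i j show False
          by (cases i j rule: linorder_cases) (auto simp: mult.commute)
      qed
      then have "0 < (\<Prod>i\<in>{1..n} - {j}. 1 - (cmod (z i))\<^sup>2)"
        by (intro prod_pos) (simp add: sq_less_1_iff)
      \<comment> \<open>The other factors have positive product, so factor \<open>j\<close> carries
        the sign of the whole.\<close>
      with pos have "0 < 1 - (cmod (z j))\<^sup>2"
        using j by (simp add: prod.remove zero_less_mult_iff)
      with ge show False by (simp add: sq_less_1_iff)
    qed
    then have "z \<in> tuples n unit_disc"
      using assms(2) by (auto simp: tuples_def unit_disc_def PiE_iff)
    with assms(4) show "w \<in> symmetrized_polydisc n"
      by (auto simp: symmetrized_polydisc_def)
  qed
qed

end
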